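(* Let $n$ be an integer with $|n|\ge 2$, let $\Sigma=\{0,1,\dots,|n|-1\}$, and let $W\subseteq\mathcal W$ be a nonempty finite set of primitive words over $\Sigma$. Then there exists a least (with respect to inclusion) set $\mathrm{cl}(W)\subseteq\mathcal W$ of words such that (i) $\mathrm{cl}(W)\supseteq W$, and (ii) $\mathrm{cl}(W)=W_D$ for some complete system of residues $D$ modulo $n$ that is an arithmetic sequence. Moreover, $\mathrm{cl}(W)=W(r,h)$, where $(r,h)=\bigvee_{w\in W}(\mathrm r(w),\mathrm h(w))$ is the join (least upper bound) in the lattice $L_n$.
   Context: $\mathbb N$ denotes the positive integers. $\mathcal W$ is the set of primitive words in $\Sigma^+$ (finite nonempty words over $\Sigma$ that are not of the form $v^k$ with $k\ge2$). Words of a representation. Let $D=\{d_0<d_1<\dots<d_{|n|-1}\}$ be a complete system of residues modulo $n$ (always indexed increasingly). It induces a strong affine representation of the polycyclic monoid $\mathcal P_{|n|}$ by the maps $f_i:\mathbb Z\to\mathbb Z$, $x\mapsto nx+d_i$. Let $R:\mathbb Z\to\mathbb Z$, $R(x)=(x-d_i)/n$, where $d_i$ is the unique element of $D$ with $x\equiv d_i \pmod n$. A periodic point is an $x$ with $R^\ell(x)=x$ for some $\ell\ge1$; for the least such $\ell$, the word associated with $x$ is $i_0i_1\cdots i_{\ell-1}$, where $R^k(x)\equiv d_{i_k}\pmod n$. $W_D$ is the set of words associated with all periodic points (a finite set of primitive words, closed under cyclic shifts). $D$ is an arithmetic sequence if $d_i=d_0+ih$ for all $i\in\Sigma$, for some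 $h\in\mathbb N$ (necessarily coprime to $n$). Fractions. $(c_{m}\ldots c_0.c_{-1}c_{-2}\ldots)_n$ denotes $\sum_{i\le m}c_in^i$ with digits $c_i\in\Sigma$. $I_n$ is the set of reals of the form $(0.c_{-1}c_{-2}\ldots)_n$; it equals $[0,1]$ if $n\ge2$ and $\left[\frac{-n}{n-1},\frac{-1}{n-1}\right]$ if $n\le-2$. For $w=c_0c_1\cdots c_{\ell-1}\in\Sigma^+$ let $$\mathrm q(w)=(0.c_{\ell-1}\ldots c_0c_{\ell-1}\ldots c_0\ldots)_n=\frac{\sum_{i=0}^{\ell-1}c_in^i}{n^\ell-1}.$$ For $r\in\{0,1,\dots,|n-1|-1\}$ and $h\in\mathbb N$ coprime to $n$ let $$Q(r,h)=\left\{q\in I_n : \exists a\in\mathbb Z,\ q=\tfrac{a}{h(n-1)},\ a\equiv r \pmod{n-1}\right\},\qquad W(r,h)=\{w\in\mathcal W:\mathrm q(w)\in Q(r,h)\}.$$ For $w\in\mathcal W$, let $\mathrm a(w)/\mathrm h(w)$ be the reduced form of the rational number $(n-1)\,\mathrm q(w)$, with $\mathrm h(w)>0$ ($\mathrm a(w)$ may be negative), and let $\mathrm r(w)\in\{0,\dots,|n-1|-1\}$ with $\mathrm r(w)\equiv\mathrm a(w)\pmod{n-1}$. The lattice $L_n$. $L_n=\big(\{0,1,\dots,|n-1|-1\}\times\{h\in\mathbb N:\gcd(h,n)=1\}\big)\cup\{\bot\}$, where $\bot$ is the least element and $(r_1,h_1)\le(r_2,h_2)$ iff $h_1\mid h_2$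 and $r_1\cdot\frac{h_2}{h_1}\equiv r_2\pmod{n-1}$. This is a lattice order. *)

theory Defs
  imports Complex_Main "HOL-Number_Theory.Cong" "HOL-Algebra.Lattice"
begin

section \<open>Words\<close>

definition alphabet :: "int \<Rightarrow> nat set" where
  "alphabet n = {i. int i < \<bar>n\<bar>}"

definition primitive :: "'a list \<Rightarrow> bool" where
  "primitive w \<longleftrightarrow> w \<noteq> [] \<and> \<not> (\<exists>v k. k \<ge> 2 \<and> w = concat (replicate k v))"

definition prim_words :: "int \<Rightarrow> nat list set" where
  "prim_words n = {w \<in> lists (alphabet n). primitive w}"

section \<open>The words of a complete system of residues\<close>

definition complete_residue_system :: "int \<Rightarrow> int set \<Rightarrow> bool" where
  "complete_residue_system n D \<longleftrightarrow> (\<forall>x. \<exists>!d. d \<in> D \<and> [x = d] (mod n))"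

text \<open>A complete system of residues modulo \<open>n \<noteq> 0\<close> is finite with \<open>\<bar>n\<bar>\<close> elements, so that
  \<open>res_elem D i\<close> is \<open>d\<^sub>i\<close> in the increasing enumeration \<open>d\<^sub>0 < d\<^sub>1 < \<dots>\<close> of \<open>D\<close>.\<close>

lemma complete_residue_system_bij_betw:
  assumes "n \<noteq> 0" "complete_residue_system n D"
  shows "bij_betw (\<lambda>d. d mod \<bar>n\<bar>) D {0..<\<bar>n\<bar>}"
proof -
  have c: "[x = y] (mod n) \<longleftrightarrow> x mod \<bar>n\<bar> = y mod \<bar>n\<bar>" for x y
    by (metis cong_abs cong_def)
  show ?thesis
    unfolding bij_betw_def
  proof
    show "inj_on (\<lambda>d. d mod \<bar>n\<bar>) D"
    proof (rule inj_onI)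
      fix x y assume "x \<in> D" "y \<in> D" "x mod \<bar>n\<bar> = y mod \<bar>n\<bar>"
      then show "x = y"
        using assms(2) c unfolding complete_residue_system_def by blast
    qed
    show "(\<lambda>d. d mod \<bar>n\<bar>) ` D = {0..<\<bar>n\<bar>}"
    proof
      show "(\<lambda>d. d mod \<bar>n\<bar>) ` D \<subseteq> {0..<\<bar>n\<bar>}" using assms(1) by auto
      show "{0..<\<bar>n\<bar>} \<subseteq> (\<lambda>d. d mod \<bar>n\<bar>) ` D"
      proof
        fix x assume x: "x \<in> {0..<\<bar>n\<bar>}"
        obtain d where "d \<in> D" "x mod \<bar>n\<bar> = d mod \<bar>n\<bar>"
          using assms(2) c unfolding complete_residue_system_def by blast
        then show "x \<in> (\<lambda>d. d mod \<bar>n\<bar>) ` D" using x by auto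
      qed
    qed
  qed
qed

lemma complete_residue_system_finite_card:
  assumes "n \<noteq> 0" "complete_residue_system n D"
  shows "finite D" "card D = nat \<bar>n\<bar>"
  using bij_betw_finite[OF complete_residue_system_bij_betw[OF assms]]
    bij_betw_same_card[OF complete_residue_system_bij_betw[OF assms]] by auto

definition res_elem :: "int set \<Rightarrow> nat \<Rightarrow> int" where
  "res_elem D i = sorted_list_of_set D ! i"

definition arithmetic_sequence :: "int \<Rightarrow> int set \<Rightarrow> bool" where
  "arithmetic_sequence n D \<longleftrightarrow>
     (\<exists>h>0. \<forall>i\<in>alphabet n. res_elem D i = res_elem D 0 + int i * h)"

definition digit :: "int \<Rightarrow> int set \<Rightarrow> int \<Rightarrow> nat" where
  "digit n D x = (THE i. i \<in> alphabet n \<and> [x = res_elem D i] (mod n))"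

text \<open>The division is exact.\<close>

definition R_map :: "int \<Rightarrow> int set \<Rightarrow> int \<Rightarrow> int" where
  "R_map n D x = (x - res_elem D (digit n D x)) div n"

definition periodic_point :: "int \<Rightarrow> int set \<Rightarrow> int \<Rightarrow> bool" where
  "periodic_point n D x \<longleftrightarrow> (\<exists>l\<ge>1. (R_map n D ^^ l) x = x)"

definition period :: "int \<Rightarrow> int set \<Rightarrow> int \<Rightarrow> nat" where
  "period n D x = (LEAST l. l \<ge> 1 \<and> (R_map n D ^^ l) x = x)"

definition point_word :: "int \<Rightarrow> int set \<Rightarrow> int \<Rightarrow> nat list" where
  "point_word n D x = map (\<lambda>k. digit n D ((R_map n D ^^ k) x)) [0..<period n D x]"

definition rep_words :: "int \<Rightarrow> int set \<Rightarrow> nat list set" where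
  "rep_words n D = {point_word n D x | x. periodic_point n D x}"

section \<open>Fractions in base \<open>n\<close>\<close>

text \<open>\<open>frac_val n c\<close> is \<open>(0.c\<^sub>-\<^sub>1c\<^sub>-\<^sub>2\<dots>)\<^sub>n\<close>, the digit \<open>c\<^sub>-\<^sub>k\<^sub>-\<^sub>1\<close> being given as \<open>c k\<close>.\<close>

definition frac_val :: "int \<Rightarrow> (nat \<Rightarrow> nat) \<Rightarrow> real" where
  "frac_val n c = (\<Sum>k. real (c k) / of_int n ^ Suc k)"

definition I_frac :: "int \<Rightarrow> real set" where
  "I_frac n = {frac_val n c | c. range c \<subseteq> alphabet n}"

definition q_val :: "int \<Rightarrow> nat list \<Rightarrow> rat" where
  "q_val n w = (\<Sum>i<length w. of_nat (w ! i) * of_int n ^ i) / (of_int n ^ length w - 1)"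

lemma summable_frac_val:
  assumes "\<bar>n\<bar> \<ge> 2" "range c \<subseteq> alphabet n"
  shows "summable (\<lambda>k. real (c k) / of_int n ^ Suc k)"
proof (rule summable_comparison_test')
  have n: "\<bar>real_of_int n\<bar> \<ge> 2" using assms(1) by linarith
  show "summable (\<lambda>k. (1 / \<bar>real_of_int n\<bar>) ^ k)"
    by (rule summable_geometric) (use n in auto)
  fix k :: nat
  have "int (c k) < \<bar>n\<bar>" using assms(2) by (auto simp: alphabet_def)
  then have "real (c k) \<le> \<bar>real_of_int n\<bar>" by linarith
  then show "norm (real (c k) / of_int n ^ Suc k) \<le> (1 / \<bar>real_of_int n\<bar>) ^ k"
    using n by (simp add: power_abs abs_mult divide_simps)
qed

text \<open>\<open>q_val n w\<close> is the value of the periodic expansion \<open>(0.c\<^sub>l\<^sub>-\<^sub>1\<dots>c\<^sub>0c\<^sub>l\<^sub>-\<^sub>1\<dots>c\<^sub>0\<dots>)\<^sub>n\<close>,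
  where \<open>w = c\<^sub>0\<dots>c\<^sub>l\<^sub>-\<^sub>1\<close>.\<close>

lemma q_val_eq_frac_val:
  assumes n: "\<bar>n\<bar> \<ge> 2" and w: "w \<noteq> []" "w \<in> lists (alphabet n)"
  shows "of_rat (q_val n w) = frac_val n (\<lambda>k. w ! (length w - 1 - k mod length w))"
proof -
  define l where "l = length w"
  define b where "b = real_of_int n"
  define c where "c = (\<lambda>k. w ! (l - 1 - k mod l))"
  define f where "f = (\<lambda>k. real (c k) / b ^ Suc k)"
  have l: "l > 0" using w(1) by (simp add: l_def)
  have b2: "\<bar>b\<bar> \<ge> 2" using n unfolding b_def by linarith
  then have b0: "b \<noteq> 0" by auto
  have "1 < \<bar>b\<bar> ^ l" using b2 l by (intro one_less_power) auto
  then have bl: "b ^ l \<noteq> 1" by (metis abs_1 less_irrefl power_abs)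
  have "c k \<in> alphabet n" for k
  proof -
    have "l - 1 - k mod l < length w" using l by (simp add: l_def)
    then show ?thesis using w(2) unfolding c_def by (auto simp: in_lists_conv_set)
  qed
  then have sm: "summable f"
    unfolding f_def b_def by (intro summable_frac_val[OF n]) auto
  have shift: "f (k + l) = f k / b ^ l" for k
    by (simp add: f_def c_def power_add)
  have "suminf f = (\<Sum>k. f (k + l)) + (\<Sum>k<l. f k)"
    by (rule suminf_split_initial_segment[OF sm])
  also have "(\<Sum>k. f (k + l)) = suminf f / b ^ l"
    unfolding shift by (rule suminf_divide[OF sm])
  finally have 1: "suminf f = suminf f / b ^ l + (\<Sum>k<l. f k)" .
  have "(\<Sum>k<l. f k) = (\<Sum>k<l. f (l - Suc k))"
    by (rule sum.nat_diff_reindex[symmetric])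
  also have "\<dots> = (\<Sum>k<l. real (w ! k) * b ^ k / b ^ l)"
  proof (rule sum.cong[OF refl])
    fix k assume "k \<in> {..<l}"
    then have k: "k < l" by simp
    then have "c (l - Suc k) = w ! k" unfolding c_def by simp
    moreover have "b ^ l = b ^ Suc (l - Suc k) * b ^ k"
      using k by (simp flip: power_add power_Suc)
    ultimately show "f (l - Suc k) = real (w ! k) * b ^ k / b ^ l"
      using b0 unfolding f_def by simp
  qed
  also have "\<dots> = (\<Sum>k<l. real (w ! k) * b ^ k) / b ^ l"
    by (simp add: sum_divide_distrib)
  finally have "suminf f = suminf f / b ^ l + (\<Sum>k<l. real (w ! k) * b ^ k) / b ^ l"
    using 1 by simp
  then have "suminf f = (\<Sum>k<l. real (w ! k) * b ^ k) / (b ^ l - 1)"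
    using b0 bl by (simp add: field_simps)
  then show ?thesis
    unfolding q_val_def frac_val_def f_def c_def b_def l_def
    by (simp add: of_rat_divide of_rat_sum of_rat_mult of_rat_power of_rat_diff)
qed

definition Q_set :: "int \<Rightarrow> int \<Rightarrow> int \<Rightarrow> real set" where
  "Q_set n r h = {x \<in> I_frac n. \<exists>a::int. x = of_int a / of_int (h * (n - 1)) \<and> [a = r] (mod (n - 1))}"

definition W_rh :: "int \<Rightarrow> int \<Rightarrow> int \<Rightarrow> nat list set" where
  "W_rh n r h = {w \<in> prim_words n. of_rat (q_val n w) \<in> Q_set n r h}"

text \<open>\<^const>\<open>quotient_of\<close> yields the reduced form with positive denominator.\<close>

definition a_w :: "int \<Rightarrow> nat list \<Rightarrow> int" where
  "a_w n w = fst (quotient_of (of_int (n - 1) * q_val n w))"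

definition h_w :: "int \<Rightarrow> nat list \<Rightarrow> int" where
  "h_w n w = snd (quotient_of (of_int (n - 1) * q_val n w))"

text \<open>The modulus is \<open>\<bar>n - 1\<bar>\<close> because \<open>mod\<close> takes the sign of its second argument.\<close>

definition r_w :: "int \<Rightarrow> nat list \<Rightarrow> int" where
  "r_w n w = a_w n w mod \<bar>n - 1\<bar>"

section \<open>The lattice \<open>L\<^sub>n\<close>\<close>

text \<open>\<^const>\<open>None\<close> is the least element \<open>\<bottom>\<close>.\<close>

fun L_le :: "int \<Rightarrow> (int \<times> int) option \<Rightarrow> (int \<times> int) option \<Rightarrow> bool" where
  "L_le n None y \<longleftrightarrow> True"
| "L_le n (Some x) None \<longleftrightarrow> False"
| "L_le n (Some (r1, h1)) (Some (r2, h2)) \<longleftrightarrow>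
     h1 dvd h2 \<and> [r1 * (h2 div h1) = r2] (mod (n - 1))"

definition L_lat :: "int \<Rightarrow> (int \<times> int) option gorder" where
  "L_lat n = \<lparr>carrier = Some ` ({0..<\<bar>n - 1\<bar>} \<times> {h. h > 0 \<and> coprime h n}) \<union> {None},
          eq = (=), le = L_le n\<rparr>"

section \<open>Candidates for the closure of \<open>W\<close>\<close>

definition arithmetic_rep_cover :: "int \<Rightarrow> nat list set \<Rightarrow> nat list set \<Rightarrow> bool" where
  "arithmetic_rep_cover n W V \<longleftrightarrow>
     V \<subseteq> prim_words n \<and> W \<subseteq> V \<and>
     (\<exists>D. complete_residue_system n D \<and> arithmetic_sequence n D \<and> V = rep_words n D)"

end

theory Submission
  imports Defs
begin

text \<open>
  Let \<open>D\<close> consist of the \<open>d + i h\<close>. A word \<open>w = c\<^sub>0\<dots>c\<^sub>l\<^sub>-\<^sub>1\<close> lists the digits of a point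
  returning to itself after \<open>l\<close> steps iff the composition of the maps \<open>x \<mapsto> n x + d + c\<^sub>k h\<close>
  has an integral fixed point. Its only rational fixed point is
  \<open>- (d + h (n - 1) q(w)) / (n - 1)\<close>, so that \<open>W\<^sub>D = W(r, h)\<close> with \<open>r \<equiv> - d\<close> modulo \<open>n - 1\<close>.
  On the other hand, \<open>w \<in> W(r, h)\<close> says exactly that \<open>(r(w), h(w)) \<le> (r, h)\<close> in \<open>L\<^sub>n\<close>.
  The sets \<open>W\<^sub>D\<close> covering \<open>W\<close> thus correspond to the upper bounds of the pairs \<open>(r(w), h(w))\<close>,
  and the least one to their join. The join exists because the second components of the upper
  bounds are the positive elements, coprime to \<open>n\<close>, of an ideal of the integers.
\<close>

section \<open>Digits and fixed points\<close>

lemma res_elem_bij_betw: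
  assumes "n \<noteq> 0" "complete_residue_system n D"
  shows "bij_betw (res_elem D) (alphabet n) D"
proof -
  note fc = complete_residue_system_finite_card[OF assms]
  have "alphabet n = {..<length (sorted_list_of_set D)}"
    using fc by (auto simp: alphabet_def)
  moreover have "bij_betw ((!) (sorted_list_of_set D)) {..<length (sorted_list_of_set D)} D"
    using fc by (intro bij_betw_nth) auto
  ultimately show ?thesis
    by (simp add: res_elem_def[abs_def])
qed

text \<open>Ensures that the definite description in \<open>digit\<close> denotes an index, for any
  nonzero \<open>n\<close>.\<close>

lemma res_elem_ex1:
  assumes "n \<noteq> 0" "complete_residue_system n D"
  shows "\<exists>!i. i \<in> alphabet n \<and> [x = res_elem D i] (mod n)"
proof -
  note bij = res_elem_bij_betw[OF assms]
  obtain d where d: "d \<in> D" "[x = d] (mod n)" "\<And>d'. d' \<in> D \<Longrightarrow> [x = d'] (mod n) \<Longrightarrow> d' = d"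
    using assms(2) unfolding complete_residue_system_def by blast
  have "d \<in> res_elem D ` alphabet n"
    by (simp add: bij_betw_imp_surj_on[OF bij] d(1))
  then obtain i where i: "i \<in> alphabet n" "res_elem D i = d"
    by blast
  show ?thesis
  proof (rule ex1I[of _ i])
    show "i \<in> alphabet n \<and> [x = res_elem D i] (mod n)"
      using i d(2) by simp
    fix j assume j: "j \<in> alphabet n \<and> [x = res_elem D j] (mod n)"
    then have "res_elem D j = res_elem D i"
      using d(3)[of "res_elem D j"] i bij by (auto simp: bij_betw_def)
    then show "j = i"
      using i j bij by (auto simp: bij_betw_def dest: inj_onD)
  qed
qed

section \<open>Digit words and compositions of the affine maps\<close>

definition digits :: "int \<Rightarrow> int set \<Rightarrow> int \<Rightarrow> nat \<Rightarrow> nat list" where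
  "digits n D x l = map (\<lambda>k. digit n D ((R_map n D ^^ k) x)) [0..<l]"

text \<open>The head of the word is applied outermost, because the first digit of \<open>x\<close>
  belongs to the map that recovers \<open>x\<close> from \<open>R_map n D x\<close>. Composing along
  a digit word thus reverses the iteration of \<open>R_map\<close>.\<close>

definition comp_word :: "int \<Rightarrow> int set \<Rightarrow> nat list \<Rightarrow> int \<Rightarrow> int" where
  "comp_word n D w x = foldr (\<lambda>i y. n * y + res_elem D i) w x"

lemma comp_word_simps [simp]:
  "comp_word n D [] x = x"
  "comp_word n D (i # w) x = n * comp_word n D w x + res_elem D i"
  "comp_word n D (v @ w) x = comp_word n D v (comp_word n D w x)"
  by (simp_all add: comp_word_def)

lemma length_digits [simp]: "length (digits n D x l) = l"
  by (simp add: digits_def)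

lemma digits_0 [simp]: "digits n D x 0 = []"
  by (simp add: digits_def)

lemma digits_Suc: "digits n D x (Suc l) = digit n D x # digits n D (R_map n D x) l"
  unfolding digits_def upt_conv_Cons[OF zero_less_Suc] map_Suc_upt[symmetric]
  by (simp add: funpow_swap1)

lemma digits_add:
  "digits n D x (k + l) = digits n D x k @ digits n D ((R_map n D ^^ k) x) l"
  by (induction k arbitrary: x) (simp_all add: digits_Suc funpow_swap1)

lemma digits_mult:
  assumes "(R_map n D ^^ p) x = x"
  shows "digits n D x (k * p) = concat (replicate k (digits n D x p))"
  using assms by (induction k) (simp_all add: digits_add)

text \<open>Each map has slope \<open>n\<close>, so the composition is affine with slope
  \<open>n ^ length w\<close>, and the constant term cancels in the difference.\<close>

lemma comp_word_diff: "comp_word n D w x - comp_word n D w y = n ^ length w * (x - y)"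
proof (induction w)
  case (Cons i w)
  have "comp_word n D (i # w) x - comp_word n D (i # w) y
      = n * (comp_word n D w x - comp_word n D w y)"
    by (simp add: algebra_simps)
  then show ?case
    using Cons by (simp add: algebra_simps)
qed simp

lemma power_ne_1_int:
  fixes n :: int
  assumes "\<bar>n\<bar> \<ge> 2" "l > 0"
  shows "n ^ l \<noteq> 1"
proof -
  have "1 < \<bar>n\<bar> ^ l"
    using assms by (intro one_less_power) auto
  then show ?thesis
    by (metis abs_1 less_irrefl power_abs)
qed

text \<open>The difference of two fixed points equals itself times the slope, and the slope is not
  1.\<close>

lemma comp_word_fixed_unique:
  assumes "\<bar>n\<bar> \<ge> 2" "w \<noteq> []" "comp_word n D w x = x" "comp_word n D w y = y"
  shows "x = y"
proof -
  have "x - y = n ^ length w * (x - y)"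
    using comp_word_diff[of n D w x y] assms(3,4) by simp
  then show ?thesis
    using power_ne_1_int[of n "length w"] assms(1,2) by simp
qed

text \<open>Since \<open>v\<close> commutes with its powers, its composition sends a fixed point of
  the power to a fixed point of the power, and there is only one.\<close>

lemma comp_word_power_fixed:
  assumes n: "\<bar>n\<bar> \<ge> 2" and v: "v \<noteq> []" and k: "k > 0"
    and fixed: "comp_word n D (concat (replicate k v)) x = x"
  shows "comp_word n D v x = x"
proof (rule comp_word_fixed_unique[OF n])
  show "concat (replicate k v) \<noteq> []"
    using v k by simp
  have "concat (replicate k v) @ v = v @ concat (replicate k v)"
    by (induction k) simp_all
  then have "comp_word n D (concat (replicate k v) @ v) x = comp_word n D v x"
    using fixed by simp
  then show "comp_word n D (concat (replicate k v)) (comp_word n D v x) = comp_word n D v x"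
    by simp
qed (use fixed in simp)

section \<open>Periodic points and their words for one residue system\<close>

context
  fixes n :: int and D :: "int set"
  assumes n: "\<bar>n\<bar> \<ge> 2" and D: "complete_residue_system n D"
begin

lemma digit_props: "digit n D x \<in> alphabet n" "[x = res_elem D (digit n D x)] (mod n)"
proof -
  have "n \<noteq> 0" using n by auto
  from theI'[OF res_elem_ex1[OF this D, of x]]
  show "digit n D x \<in> alphabet n" "[x = res_elem D (digit n D x)] (mod n)"
    unfolding digit_def by blast+
qed

lemma R_map_step: "n * R_map n D x + res_elem D (digit n D x) = x"
proof -
  have "n dvd x - res_elem D (digit n D x)"
    using digit_props(2) by (simp add: cong_iff_dvd_diff)
  then show ?thesis
    by (simp add: R_map_def)
qed

lemma digit_step:
  assumes "i \<in> alphabet n"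
  shows "digit n D (n * x + res_elem D i) = i"
proof -
  have "n \<noteq> 0" using n by auto
  have "[n * x + res_elem D i = res_elem D i] (mod n)"
    by (simp add: cong_iff_dvd_diff)
  then show ?thesis
    unfolding digit_def using assms by (intro the1_equality res_elem_ex1[OF \<open>n \<noteq> 0\<close> D]) simp
qed

lemma R_map_inverse:
  assumes "i \<in> alphabet n"
  shows "R_map n D (n * x + res_elem D i) = x"
proof -
  have "n \<noteq> 0" using n by auto
  then show ?thesis
    by (simp add: R_map_def digit_step[OF assms])
qed

lemma digits_in_lists: "digits n D x l \<in> lists (alphabet n)"
  by (auto simp: digits_def digit_props)

lemma comp_word_digits: "comp_word n D (digits n D x l) ((R_map n D ^^ l) x) = x"
proof (induction l arbitrary: x)
  case (Suc l)
  then show ?case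
    using Suc[of "R_map n D x"] by (simp add: digits_Suc funpow_swap1 R_map_step)
qed simp

text \<open>\<open>R_map\<close> strips the outermost map, and the digit read at that moment is the
  index of this map.\<close>

lemma R_map_comp_word:
  assumes "w \<in> lists (alphabet n)"
  shows "(R_map n D ^^ length w) (comp_word n D w x) = x"
    and "digits n D (comp_word n D w x) (length w) = w"
  using assms by (induction w) (auto simp: funpow_swap1 R_map_inverse digits_Suc digit_step)

lemma period_props:
  assumes "periodic_point n D x"
  shows "period n D x \<ge> 1" "(R_map n D ^^ period n D x) x = x"
    and "\<And>l. l \<ge> 1 \<Longrightarrow> (R_map n D ^^ l) x = x \<Longrightarrow> period n D x \<le> l"
proof -
  have "\<exists>l. l \<ge> 1 \<and> (R_map n D ^^ l) x = x"
    using assms by (simp add: periodic_point_def)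
  from LeastI_ex[OF this]
  show "period n D x \<ge> 1" "(R_map n D ^^ period n D x) x = x"
    unfolding period_def by auto
  show "period n D x \<le> l" if "l \<ge> 1" "(R_map n D ^^ l) x = x" for l
    unfolding period_def by (rule Least_le) (use that in simp)
qed

text \<open>If the word were a proper power of \<open>v\<close>, its fixed point \<open>x\<close>
  would also be fixed by the composition along \<open>v\<close>. Then \<open>x\<close> would return
  after \<open>length v\<close> steps, before its least period.\<close>

lemma rep_words_subset:
  assumes "w \<in> rep_words n D"
  shows "w \<in> prim_words n" "\<exists>x. comp_word n D w x = x"
proof -
  obtain x where per: "periodic_point n D x" and w: "w = digits n D x (period n D x)"
    using assms by (auto simp: rep_words_def point_word_def digits_def)
  note pp = period_props[OF per]
  have fixed: "comp_word n D w x = x"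
    using comp_word_digits[of x "period n D x"] pp(2) by (simp add: w)
  then show "\<exists>x. comp_word n D w x = x" ..
  have len: "length w = period n D x"
    by (simp add: w)
  have "primitive w"
    unfolding primitive_def
  proof
    show "w \<noteq> []" using len pp(1) by auto
    show "\<not> (\<exists>v k. k \<ge> 2 \<and> w = concat (replicate k v))"
    proof
      assume "\<exists>v k. k \<ge> 2 \<and> w = concat (replicate k v)"
      then obtain v k where k: "k \<ge> 2" and wk: "w = concat (replicate k v)" by blast
      have v: "v \<noteq> []"
        using \<open>w \<noteq> []\<close> wk by auto
      have "set v \<subseteq> set w"
        using k wk by auto
      then have vl: "v \<in> lists (alphabet n)"
        using digits_in_lists[of x "period n D x"] w by (auto simp: in_lists_conv_set)
      have "comp_word n D v x = x"
        using comp_word_power_fixed[OF n v _ fixed[unfolded wk]] k by simp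
      then have "(R_map n D ^^ length v) x = x"
        using R_map_comp_word(1)[OF vl, of x] by simp
      then have "length w \<le> length v"
        using pp(3)[of "length v"] v len by (simp add: Suc_le_eq)
      moreover have "length w = k * length v"
        using wk by (simp add: length_concat sum_list_replicate)
      ultimately show False
        using k v by simp
    qed
  qed
  then show "w \<in> prim_words n"
    using digits_in_lists w by (simp add: prim_words_def)
qed

text \<open>The fixed point returns after \<open>length w\<close> steps, so \<open>w\<close> is a
  power of the word read over one least period; primitivity makes the exponent 1.\<close>

lemma fixed_word_in_rep_words:
  assumes w: "w \<in> prim_words n" and fixed: "comp_word n D w x = x"
  shows "w \<in> rep_words n D"
proof -
  have wl: "w \<in> lists (alphabet n)" and wp: "primitive w"
    using w by (auto simp: prim_words_def)
  have R: "(R_map n D ^^ length w) x = x" and dig: "digits n D x (length w) = w"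
    using R_map_comp_word[OF wl, of x] fixed by simp_all
  have "length w \<ge> 1"
    using wp by (simp add: primitive_def Suc_le_eq)
  then have per: "periodic_point n D x"
    using R by (auto simp: periodic_point_def)
  note pp = period_props[OF per]
  let ?p = "period n D x"
  \<comment> \<open>The remainder is again a return time and is below the least positive one, hence
    it is 0 and the period divides \<open>length w\<close>.\<close>
  have "(R_map n D ^^ (length w mod ?p)) x = x"
    using funpow_mod_eq[OF pp(2)] R by simp
  moreover have "length w mod ?p < ?p"
    using pp(1) by simp
  ultimately have "length w mod ?p = 0"
    using pp(3)[of "length w mod ?p"] by linarith
  then obtain k where k: "length w = k * ?p"
    by (metis dvd_div_mult_self mod_0_imp_dvd)
  have wk: "w = concat (replicate k (digits n D x ?p))"
    using digits_mult[OF pp(2), of k] dig k by simp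
  have "\<not> k \<ge> 2"
    using wp wk unfolding primitive_def by blast
  moreover have "k \<noteq> 0"
    using k \<open>length w \<ge> 1\<close> by auto
  ultimately have "k = 1" by simp
  then have "w = point_word n D x"
    using wk by (simp add: point_word_def digits_def)
  then show ?thesis
    using per by (auto simp: rep_words_def)
qed

lemma rep_words_eq: "rep_words n D = {w \<in> prim_words n. \<exists>x. comp_word n D w x = x}"
  using rep_words_subset fixed_word_in_rep_words by blast

end

section \<open>Arithmetic residue systems\<close>

text \<open>The numerator of \<open>q_val n w\<close> over \<open>n ^ length w - 1\<close>, kept as
  an integer so that fixed point equations can be handled in the integers.\<close>

definition word_num :: "int \<Rightarrow> nat list \<Rightarrow> int" where
  "word_num n w = (\<Sum>i<length w. int (w ! i) * n ^ i)"

lemma word_num_simps [simp]: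
  "word_num n [] = 0"
  "word_num n (i # w) = int i + n * word_num n w"
  by (simp_all add: word_num_def sum.lessThan_Suc_shift sum_distrib_left mult_ac
      del: sum.lessThan_Suc)

lemma q_val_mult:
  assumes "\<bar>n\<bar> \<ge> 2" "w \<noteq> []"
  shows "of_int (n ^ length w - 1) * q_val n w = of_int (word_num n w)"
proof -
  have "(of_int (n ^ length w - 1) :: rat) \<noteq> 0"
    using power_ne_1_int[of n "length w"] assms by (simp del: of_int_diff of_int_power)
  then show ?thesis
    by (simp add: q_val_def word_num_def)
qed

text \<open>The factor \<open>n - 1\<close> turns the geometric sum of the contributions of
  \<open>d\<close> into \<open>d * (n ^ length w - 1)\<close> without a division.\<close>

lemma comp_word_arithmetic:
  assumes "\<forall>i\<in>alphabet n. res_elem D i = d + int i * h" "w \<in> lists (alphabet n)"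
  shows "(n - 1) * comp_word n D w x
    = (n - 1) * n ^ length w * x + d * (n ^ length w - 1) + (n - 1) * h * word_num n w"
  using assms(2)
proof (induction w)
  case (Cons i w)
  have "(n - 1) * comp_word n D (i # w) x
      = n * ((n - 1) * comp_word n D w x) + (n - 1) * (d + int i * h)"
    using assms(1) Cons.hyps(1) by (simp add: algebra_simps)
  also have "\<dots> = (n - 1) * n ^ length (i # w) * x + d * (n ^ length (i # w) - 1)
      + (n - 1) * h * word_num n (i # w)"
    unfolding Cons.IH by (simp add: algebra_simps)
  finally show ?case .
qed simp

text \<open>Collecting the terms in \<open>x\<close> leaves the common factor
  \<open>n ^ length w - 1\<close>; cancelling it replaces \<open>word_num n w\<close> by
  \<open>q_val n w\<close>.\<close>

lemma comp_word_fixed_iff: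
  assumes n: "\<bar>n\<bar> \<ge> 2" and e: "\<forall>i\<in>alphabet n. res_elem D i = d + int i * h"
    and w: "w \<in> lists (alphabet n)" "w \<noteq> []"
  shows "comp_word n D w x = x
    \<longleftrightarrow> of_int (h * (n - 1)) * q_val n w = of_int (- d - (n - 1) * x)"
proof -
  let ?N = "n ^ length w - 1"
  have N: "?N \<noteq> 0" "(of_int ?N :: rat) \<noteq> 0"
    using power_ne_1_int[of n "length w"] n w(2) by (simp_all del: of_int_diff of_int_power)
  have "n - 1 \<noteq> 0" using n by auto
  then have "comp_word n D w x = x \<longleftrightarrow> (n - 1) * comp_word n D w x = (n - 1) * x"
    by simp
  also have "\<dots> \<longleftrightarrow> h * (n - 1) * word_num n w = ?N * (- d - (n - 1) * x)"
    unfolding comp_word_arithmetic[OF e w(1)] by (auto simp: algebra_simps)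
  also have "\<dots> \<longleftrightarrow> of_int (h * (n - 1)) * (of_int (word_num n w) :: rat)
      = of_int ?N * of_int (- d - (n - 1) * x)"
    by (simp only: of_int_mult[symmetric] of_int_eq_iff)
  also have "\<dots> \<longleftrightarrow> of_int ?N * (of_int (h * (n - 1)) * q_val n w)
      = of_int ?N * of_int (- d - (n - 1) * x)"
    unfolding q_val_mult[OF n w(2), symmetric] by (simp only: mult.left_commute)
  also have "\<dots> \<longleftrightarrow> of_int (h * (n - 1)) * q_val n w = of_int (- d - (n - 1) * x)"
    using N(2) by (simp only: mult_cancel_left) simp
  finally show ?thesis .
qed

text \<open>Membership in \<open>I_frac n\<close> comes from the periodic expansion of
  \<open>q_val n w\<close>; the remaining equation relates rationals embedded in the reals and is
  pulled back to \<open>rat\<close>.\<close>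

lemma W_rh_iff:
  assumes n: "\<bar>n\<bar> \<ge> 2" and h: "h > 0" and w: "w \<in> prim_words n"
  shows "w \<in> W_rh n r h
    \<longleftrightarrow> (\<exists>a. of_int (h * (n - 1)) * q_val n w = of_int a \<and> [a = r] (mod (n - 1)))"
proof -
  have wl: "w \<noteq> []" "w \<in> lists (alphabet n)"
    using w by (auto simp: prim_words_def primitive_def)
  have "w ! (length w - 1 - k mod length w) \<in> alphabet n" for k
  proof -
    have "length w - 1 - k mod length w < length w" using wl(1) by simp
    then show ?thesis using wl(2) by (auto simp: in_lists_conv_set)
  qed
  then have "of_rat (q_val n w) \<in> I_frac n"
    unfolding I_frac_def q_val_eq_frac_val[OF n wl] by auto
  moreover have "of_rat (q_val n w) = (of_int a / of_int (h * (n - 1)) :: real)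
      \<longleftrightarrow> of_int (h * (n - 1)) * q_val n w = of_int a" for a
  proof -
    have "h * (n - 1) \<noteq> 0"
      using n h by auto
    then have nz: "(of_int (h * (n - 1)) :: rat) \<noteq> 0"
      by (simp only: of_int_eq_0_iff) simp
    have "(of_int a / of_int (h * (n - 1)) :: real) = of_rat (of_int a / of_int (h * (n - 1)))"
      by (simp only: of_rat_divide of_rat_of_int_eq)
    then have "of_rat (q_val n w) = (of_int a / of_int (h * (n - 1)) :: real)
        \<longleftrightarrow> q_val n w = of_int a / of_int (h * (n - 1))"
      by (simp only: of_rat_eq_iff)
    also have "\<dots> \<longleftrightarrow> of_int (h * (n - 1)) * q_val n w = of_int a"
      unfolding nonzero_eq_divide_eq[OF nz] by (simp only: mult.commute)
    finally show ?thesis .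
  qed
  ultimately show ?thesis
    using w unfolding W_rh_def Q_set_def by simp
qed

text \<open>As \<open>x\<close> runs through the integers, the right-hand side
  \<open>- d - (n - 1) * x\<close> of the fixed point equation runs through the residue class of
  \<open>r\<close> modulo \<open>n - 1\<close>.\<close>

lemma rep_words_arithmetic:
  assumes n: "\<bar>n\<bar> \<ge> 2" and D: "complete_residue_system n D" and h: "h > 0"
    and e: "\<forall>i\<in>alphabet n. res_elem D i = d + int i * h" and r: "[r = - d] (mod (n - 1))"
  shows "rep_words n D = W_rh n r h"
proof -
  have "(\<exists>x. comp_word n D w x = x) \<longleftrightarrow> w \<in> W_rh n r h" if w: "w \<in> prim_words n" for w
  proof -
    have wl: "w \<in> lists (alphabet n)" "w \<noteq> []"
      using w by (auto simp: prim_words_def primitive_def)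
    have cong: "[a = r] (mod (n - 1)) \<longleftrightarrow> (\<exists>x. a = - d - (n - 1) * x)" for a
    proof -
      have "[a = r] (mod (n - 1)) \<longleftrightarrow> [- d = a] (mod (n - 1))"
        using r by (meson cong_sym cong_trans)
      also have "\<dots> \<longleftrightarrow> (\<exists>x. - d - a = (n - 1) * x)"
        by (simp add: cong_iff_dvd_diff dvd_def)
      also have "\<dots> \<longleftrightarrow> (\<exists>x. a = - d - (n - 1) * x)"
        by (intro arg_cong[where f = Ex] ext) auto
      finally show ?thesis .
    qed
    then show ?thesis
      unfolding W_rh_iff[OF n h w] comp_word_fixed_iff[OF n e wl] cong by blast
  qed
  moreover have "W_rh n r h \<subseteq> prim_words n"
    by (auto simp: W_rh_def)
  ultimately show ?thesis
    unfolding rep_words_eq[OF n D] by blast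
qed

text \<open>Multiplication by \<open>h\<close> permutes the residues modulo \<open>n\<close>, and
  positivity of \<open>h\<close> makes the progression increasing.\<close>

lemma arithmetic_residue_system_exists:
  fixes n d h :: int
  assumes n: "\<bar>n\<bar> \<ge> 2" and h: "h > 0" and hn: "coprime h n"
  obtains D where "complete_residue_system n D"
    "\<forall>i\<in>alphabet n. res_elem D i = d + int i * h"
proof
  define L where "L = map (\<lambda>i. d + int i * h) [0..<nat \<bar>n\<bar>]"
  have alph: "alphabet n = {0..<nat \<bar>n\<bar>}"
    using n by (auto simp: alphabet_def)
  show "complete_residue_system n (set L)"
    unfolding complete_residue_system_def
  proof
    fix x
    obtain g where g: "[h * g = 1] (mod n)"
      using hn coprime_iff_invertible_int by blast
    \<comment> \<open>This solves \<open>x = d + i * h\<close> modulo \<open>n\<close> by the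
      inverse \<open>g\<close> of \<open>h\<close>. Reducing modulo \<open>\<bar>n\<bar>\<close>
      yields a letter for negative \<open>n\<close> too.\<close>
    define i where "i = nat ((g * (x - d)) mod \<bar>n\<bar>)"
    have i: "int i = (g * (x - d)) mod \<bar>n\<bar>"
      using n by (simp add: i_def)
    have "[int i = g * (x - d)] (mod n)"
      using i by (metis cong_abs cong_mod_left cong_refl)
    then have "[int i * h = g * (x - d) * h] (mod n)"
      by (rule cong_scalar_right)
    moreover have "[g * (x - d) * h = x - d] (mod n)"
      using cong_scalar_right[OF g, of "x - d"] by (simp add: mult_ac)
    ultimately have "[int i * h = x - d] (mod n)"
      by (rule cong_trans)
    then have c: "[x = d + int i * h] (mod n)"
      by (simp add: cong_iff_dvd_diff dvd_diff_commute algebra_simps)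
    have "i < nat \<bar>n\<bar>"
      using n by (simp add: i_def zless_nat_conj)
    show "\<exists>!y. y \<in> set L \<and> [x = y] (mod n)"
    proof (rule ex1I[of _ "d + int i * h"])
      show "d + int i * h \<in> set L \<and> [x = d + int i * h] (mod n)"
        using c \<open>i < nat \<bar>n\<bar>\<close> by (auto simp: L_def)
      fix y assume y: "y \<in> set L \<and> [x = y] (mod n)"
      then obtain j where j: "j < nat \<bar>n\<bar>" "y = d + int j * h"
        by (auto simp: L_def)
      have "[d + int j * h = d + int i * h] (mod n)"
        using y c j(2) by (meson cong_sym cong_trans)
      then have "[int j = int i] (mod n)"
        using hn by (simp add: cong_add_lcancel cong_mult_rcancel)
      then have "int j mod \<bar>n\<bar> = int i mod \<bar>n\<bar>"
        by (simp flip: cong_def)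
      then have "int j = int i"
        using j(1) \<open>i < nat \<bar>n\<bar>\<close> by simp
      then show "y = d + int i * h"
        using j by simp
    qed
  qed
  \<comment> \<open>Being strictly increasing, \<open>L\<close> is the sorted enumeration of its own
    set, so the index in \<open>res_elem\<close> is the multiplier of \<open>h\<close>.\<close>
  have "sorted_wrt (<) L"
    unfolding L_def sorted_wrt_map using h by (intro sorted_wrt_mono_rel[OF _ sorted_wrt_upt]) simp
  then have "sorted_list_of_set (set L) = L"
    by (intro sorted_list_of_set.idem_if_sorted_distinct) (auto simp: strict_sorted_iff)
  then show "\<forall>i\<in>alphabet n. res_elem (set L) i = d + int i * h"
    by (simp add: res_elem_def alph L_def)
qed

section \<open>The lattice\<close>

lemma L_le_trans:
  assumes "L_le n (Some (r1, h1)) (Some (r2, h2))" "L_le n (Some (r2, h2)) (Some (r3, h3))"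
    "h1 > 0" "h2 > 0"
  shows "L_le n (Some (r1, h1)) (Some (r3, h3))"
proof -
  obtain k where k: "h2 = h1 * k"
    using assms(1) by (auto elim: dvdE)
  obtain m where m: "h3 = h2 * m"
    using assms(2) by (auto elim: dvdE)
  have "k > 0"
    using k assms(3,4) by (simp add: zero_less_mult_iff)
  have 1: "[r1 * k = r2] (mod (n - 1))" and 2: "[r2 * m = r3] (mod (n - 1))"
    using assms \<open>k > 0\<close> by (auto simp: k m)
  have "[r1 * k * m = r3] (mod (n - 1))"
    using cong_trans[OF cong_scalar_right[OF 1] 2] .
  then show ?thesis
    using assms(3) by (simp add: k m mult_ac)
qed

text \<open>The number \<open>h * (n - 1) * q(w)\<close> is \<open>h * a(w) / h(w)\<close>. By
  coprimality it is an integer iff \<open>h(w)\<close> divides \<open>h\<close>, and then it is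
  \<open>a(w) * (h div h(w))\<close>, where \<open>a(w)\<close> may be replaced by
  \<open>r(w)\<close> modulo \<open>n - 1\<close>.\<close>

lemma mem_W_rh_iff_L_le:
  assumes n: "\<bar>n\<bar> \<ge> 2" and h: "h > 0" and w: "w \<in> prim_words n"
  shows "w \<in> W_rh n r h \<longleftrightarrow> L_le n (Some (r_w n w, h_w n w)) (Some (r, h))"
proof -
  let ?a = "a_w n w" and ?h = "h_w n w"
  have quot: "quotient_of (of_int (n - 1) * q_val n w) = (?a, ?h)"
    by (simp add: a_w_def h_w_def)
  have hpos: "?h > 0"
    by (rule quotient_of_denom_pos[OF quot])
  have cop: "coprime ?a ?h"
    by (rule quotient_of_coprime[OF quot])
  have q: "of_int (n - 1) * q_val n w = of_int ?a / of_int ?h"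
    by (rule quotient_of_div[OF quot])
  have eq: "of_int (h * (n - 1)) * q_val n w = of_int a \<longleftrightarrow> h * ?a = a * ?h" for a
  proof -
    have "of_int (h * (n - 1)) * q_val n w = of_int h * (of_int ?a / of_int ?h)"
      unfolding q[symmetric] by (simp only: of_int_mult mult.assoc)
    also have "\<dots> = of_int (h * ?a) / of_int ?h"
      by simp
    finally have "of_int (h * (n - 1)) * q_val n w = of_int a
        \<longleftrightarrow> of_int (h * ?a) = (of_int (a * ?h) :: rat)"
      using hpos by (simp add: divide_eq_eq)
    then show ?thesis
      by (simp only: of_int_eq_iff)
  qed
  have rw: "[r_w n w = ?a] (mod (n - 1))"
    unfolding r_w_def by (metis cong_abs cong_mod_left cong_refl)
  have "(\<exists>a. h * ?a = a * ?h \<and> [a = r] (mod (n - 1)))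
      \<longleftrightarrow> ?h dvd h \<and> [?a * (h div ?h) = r] (mod (n - 1))" (is "?L \<longleftrightarrow> ?R")
  proof
    assume ?L
    then obtain a where a: "h * ?a = a * ?h" "[a = r] (mod (n - 1))" by blast
    then have "?h dvd h * ?a" by simp
    then have dvd: "?h dvd h"
      using cop by (simp add: coprime_dvd_mult_left_iff coprime_commute)
    then obtain k where k: "h = ?h * k" by blast
    then have "a * ?h = ?a * k * ?h"
      using a(1) by (metis mult.assoc mult.commute)
    then have "a = ?a * k"
      using hpos by simp
    moreover have "h div ?h = k"
      using k hpos by (metis nonzero_mult_div_cancel_left less_irrefl)
    ultimately show ?R
      using a(2) dvd by simp
  next
    assume R: ?R
    then have "h * ?a = ?a * (h div ?h) * ?h"
      by simp
    then show ?L using R by blast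
  qed
  also have "\<dots> \<longleftrightarrow> ?h dvd h \<and> [r_w n w * (h div ?h) = r] (mod (n - 1))"
    using cong_scalar_right[OF rw, of "h div ?h"] by (meson cong_sym cong_trans)
  finally show ?thesis
    unfolding W_rh_iff[OF n h w] eq by simp
qed

text \<open>Multiplying \<open>(n - 1) * q(w)\<close> by \<open>n ^ length w - 1\<close> clears its
  denominator, so \<open>h(w)\<close> divides that number, which is coprime to
  \<open>n\<close>.\<close>

lemma h_w_pos_coprime:
  assumes n: "\<bar>n\<bar> \<ge> 2" and w: "w \<in> prim_words n"
  shows "h_w n w > 0" "coprime (h_w n w) n"
proof -
  let ?a = "a_w n w" and ?h = "h_w n w" and ?N = "n ^ length w - 1"
  have wne: "w \<noteq> []"
    using w by (auto simp: prim_words_def primitive_def)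
  have quot: "quotient_of (of_int (n - 1) * q_val n w) = (?a, ?h)"
    by (simp add: a_w_def h_w_def)
  show hpos: "?h > 0"
    by (rule quotient_of_denom_pos[OF quot])
  have q: "of_int (n - 1) * q_val n w = of_int ?a / of_int ?h"
    by (rule quotient_of_div[OF quot])
  have "of_int (n - 1) * (of_int ?N * q_val n w) = of_int ?N * (of_int ?a / (of_int ?h :: rat))"
    unfolding q[symmetric] by (simp only: mult.left_commute)
  then have "of_int ?h * (of_int (n - 1) * of_int (word_num n w)) = of_int ?N * (of_int ?a :: rat)"
    unfolding q_val_mult[OF n wne] using hpos by (simp add: field_simps)
  then have "?h * ((n - 1) * word_num n w) = ?N * ?a"
    by (simp only: of_int_mult[symmetric] of_int_eq_iff)
  then have "?h dvd ?N * ?a"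
    by (metis dvd_triv_left)
  then have "?h dvd ?N"
    using quotient_of_coprime[OF quot] by (simp add: coprime_dvd_mult_left_iff coprime_commute)
  moreover have "coprime ?N n"
  proof (rule coprimeI)
    fix c assume c: "c dvd ?N" "c dvd n"
    then have "c dvd n ^ length w"
      using wne by (meson dvd_trans dvd_power length_greater_0_conv)
    then have "c dvd n ^ length w - ?N"
      using c(1) by (rule dvd_diff)
    then show "is_unit c" by simp
  qed
  ultimately show "coprime ?h n"
    by (meson coprime_divisors dvd_refl)
qed

text \<open>The last clause ranges over all integer pairs, so that it applies directly to the pair
  read off from an arbitrary arithmetic residue system, whose residue is not reduced.\<close>

lemma L_lat_finite_lub:
  fixes n :: int
  assumes n: "\<bar>n\<bar> \<ge> 2" and P: "finite P" "P \<noteq> {}"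
    and PC: "P \<subseteq> {0..<\<bar>n - 1\<bar>} \<times> {h. h > 0 \<and> coprime h n}"
  obtains r h where "0 \<le> r" "r < \<bar>n - 1\<bar>" "h > 0" "coprime h n"
    "\<And>p. p \<in> P \<Longrightarrow> L_le n (Some p) (Some (r, h))"
    "\<And>r' h'. (\<And>p. p \<in> P \<Longrightarrow> L_le n (Some p) (Some (r', h'))) \<Longrightarrow>
       L_le n (Some (r, h)) (Some (r', h'))"
proof -
  \<comment> \<open>\<open>I\<close> collects the second components of all pairs above
    \<open>P\<close>: the residues of the members of \<open>P\<close>, carried over to
    \<open>h\<close>, must agree modulo \<open>n - 1\<close>.\<close>
  define I where "I = {h. \<forall>p\<in>P. snd p dvd h \<and>
    (\<forall>p'\<in>P. [fst p * (h div snd p) = fst p' * (h div snd p')] (mod (n - 1)))}"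
  \<comment> \<open>A positive member of \<open>I\<close>: the product makes every division exact,
    and the factor \<open>\<bar>n - 1\<bar>\<close> makes every carried residue 0.\<close>
  define N where "N = \<bar>n - 1\<bar> * (\<Prod>p\<in>P. snd p)"
  have Ppos: "snd p > 0" "coprime (snd p) n" if "p \<in> P" for p
    using PC that by auto
  have "coprime (n - 1) n"
    by (rule coprime_diff_one_left)
  then have N: "N > 0" "coprime N n"
    unfolding N_def using n Ppos by (auto intro!: mult_pos_pos prod_pos prod_coprime_left)
  have "N \<in> I"
  proof -
    have "snd p dvd N \<and> [fst p * (N div snd p) = 0] (mod (n - 1))" if p: "p \<in> P" for p
    proof -
      have "snd p dvd (\<Prod>p\<in>P. snd p)"
        using P(1) p by (rule dvd_prodI)
      then have "N div snd p = \<bar>n - 1\<bar> * ((\<Prod>p\<in>P. snd p) div snd p)" "snd p dvd N"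
        by (simp_all add: N_def div_mult_swap)
      then show ?thesis
        by (simp add: cong_0_iff)
    qed
    then show ?thesis
      unfolding I_def by (blast intro: cong_trans cong_sym)
  qed
  \<comment> \<open>This closure property is what division with remainder inside \<open>I\<close>
    requires.\<close>
  have I_diff: "x - y * k \<in> I" if x: "x \<in> I" and y: "y \<in> I" for x y k
  proof -
    have div: "(x - y * k) div snd p = x div snd p - y div snd p * k" if p: "p \<in> P" for p
    proof -
      have "snd p dvd x" "snd p dvd y"
        using p x y by (auto simp: I_def)
      then obtain s t where "x = snd p * s" "y = snd p * t"
        by blast
      moreover from this have "x - y * k = snd p * (s - t * k)"
        by (simp add: algebra_simps)
      ultimately show ?thesis
        using Ppos(1)[OF p] by simp
    qed
    have "[fst p * ((x - y * k) div snd p) = fst p' * ((x - y * k) div snd p')] (mod (n - 1))"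
      if p: "p \<in> P" and p': "p' \<in> P" for p p'
    proof -
      have "[fst p * (x div snd p) - fst p * (y div snd p) * k
          = fst p' * (x div snd p') - fst p' * (y div snd p') * k] (mod (n - 1))"
        using x y p p' unfolding I_def by (intro cong_diff cong_scalar_right) blast+
      then show ?thesis
        by (simp add: div p p' right_diff_distrib mult.assoc)
    qed
    moreover have "snd p dvd x - y * k" if "p \<in> P" for p
      using x y that unfolding I_def by (auto intro: dvd_diff)
    ultimately show ?thesis
      by (simp add: I_def)
  qed
  \<comment> \<open>The least positive element generates the ideal: the remainder of any element
    modulo \<open>h\<close> lies in \<open>I\<close> and is smaller than \<open>h\<close>, hence
    0.\<close>
  define h where "h = int (LEAST m. m > 0 \<and> int m \<in> I)"
  have ex: "\<exists>m. m > 0 \<and> int m \<in> I"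
    using N(1) \<open>N \<in> I\<close> by (intro exI[of _ "nat N"]) simp
  have hI: "h > 0" "h \<in> I"
    using LeastI_ex[OF ex] by (simp_all add: h_def)
  have h_dvd: "h dvd x" if "x \<in> I" for x
  proof -
    have "x mod h \<in> I"
      using I_diff[OF that hI(2), of "x div h"] by (simp add: minus_mult_div_eq_mod)
    moreover have "0 \<le> x mod h" "x mod h < h"
      using hI(1) by simp_all
    moreover have "h \<le> x mod h" if "x mod h \<in> I" "x mod h > 0"
    proof -
      have "(LEAST m. m > 0 \<and> int m \<in> I) \<le> nat (x mod h)"
        by (rule Least_le) (use that in simp)
      then show ?thesis
        using that(2) by (simp add: h_def)
    qed
    ultimately have "x mod h = 0" by fastforce
    then show ?thesis by presburger
  qed
  obtain p0 where p0: "p0 \<in> P" using P(2) by blast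
  \<comment> \<open>Any member of \<open>P\<close> gives the same residue, since \<open>h\<close>
    lies in \<open>I\<close>.\<close>
  define r where "r = (fst p0 * (h div snd p0)) mod \<bar>n - 1\<bar>"
  have r: "[fst p * (h div snd p) = r] (mod (n - 1))" if "p \<in> P" for p
  proof -
    have "[r = fst p0 * (h div snd p0)] (mod (n - 1))"
      unfolding r_def by (metis cong_abs cong_mod_left cong_refl)
    moreover have "[fst p * (h div snd p) = fst p0 * (h div snd p0)] (mod (n - 1))"
      using hI(2) that p0 by (simp add: I_def)
    ultimately show ?thesis
      by (meson cong_sym cong_trans)
  qed
  show ?thesis
  proof
    have "\<bar>n - 1\<bar> > 0" using n by auto
    then show "0 \<le> r" "r < \<bar>n - 1\<bar>"
      by (simp_all add: r_def)
    show "h > 0" by fact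
    show "coprime h n"
      using N(2) h_dvd[OF \<open>N \<in> I\<close>] by (meson coprime_divisors dvd_refl)
    show "L_le n (Some p) (Some (r, h))" if "p \<in> P" for p
      using r[OF that] hI(2) that by (cases p) (auto simp: I_def)
    fix r' h' assume "\<And>p. p \<in> P \<Longrightarrow> L_le n (Some p) (Some (r', h'))"
    then have ub: "snd p dvd h'" "[fst p * (h' div snd p) = r'] (mod (n - 1))" if "p \<in> P" for p
      using that by (cases p; force)+
    then have "h' \<in> I"
      unfolding I_def by (blast intro: cong_trans cong_sym)
    then have dvd: "h dvd h'" by (rule h_dvd)
    have "snd p0 dvd h"
      using hI(2) p0 by (simp add: I_def)
    \<comment> \<open>Carrying the residue of \<open>p0\<close> to \<open>h'\<close> factors through
      \<open>h\<close>, where it is \<open>r\<close>.\<close>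
    then have "h' div snd p0 = (h div snd p0) * (h' div h)"
      using dvd Ppos(1)[OF p0] hI(1) by (auto elim!: dvdE)
    then have "[fst p0 * (h div snd p0) * (h' div h) = r'] (mod (n - 1))"
      using ub(2)[OF p0] by (simp add: mult.assoc)
    moreover have "[fst p0 * (h div snd p0) * (h' div h) = r * (h' div h)] (mod (n - 1))"
      by (rule cong_scalar_right[OF r[OF p0]])
    ultimately show "L_le n (Some (r, h)) (Some (r', h'))"
      using dvd by (auto intro: cong_trans cong_sym)
  qed
qed

lemma is_lub_L_lat:
  assumes "0 \<le> r" "r < \<bar>n - 1\<bar>" "h > 0" "coprime h n" "P \<noteq> {}"
    and "P \<subseteq> {0..<\<bar>n - 1\<bar>} \<times> {h. h > 0 \<and> coprime h n}"
    and ub: "\<And>p. p \<in> P \<Longrightarrow> L_le n (Some p) (Some (r, h))"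
    and least: "\<And>r' h'. (\<And>p. p \<in> P \<Longrightarrow> L_le n (Some p) (Some (r', h'))) \<Longrightarrow>
      L_le n (Some (r, h)) (Some (r', h'))"
  shows "is_lub (L_lat n) (Some (r, h)) (Some ` P)"
  unfolding least_def
proof (intro conjI ballI)
  let ?L = "L_lat n"
  show "Upper ?L (Some ` P) \<subseteq> carrier ?L"
    by simp
  show "Some (r, h) \<in> Upper ?L (Some ` P)"
    using assms by (auto simp: Upper_def L_lat_def)
  fix y assume "y \<in> Upper ?L (Some ` P)"
  then have y: "L_le n (Some p) y" if "p \<in> P" for p
    using that assms(6) by (auto simp: Upper_def L_lat_def)
  show "le ?L (Some (r, h)) y"
  proof (cases y)
    \<comment> \<open>Bottom lies above no pair, so it cannot bound the nonempty
      \<open>P\<close>.\<close>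
    case None
    then show ?thesis
      using y \<open>P \<noteq> {}\<close> by auto
  next
    case (Some p)
    then obtain r' h' where "y = Some (r', h')"
      by (cases p) simp
    then show ?thesis
      using y least[of r' h'] unfolding L_lat_def by simp
  qed
qed

section \<open>The closure as the join\<close>

theorem theorem4p4:
  fixes n :: int and W :: "nat list set"
  assumes "\<bar>n\<bar> \<ge> 2"
    and "W \<subseteq> prim_words n" and "finite W" and "W \<noteq> {}"
  shows "\<exists>cl. arithmetic_rep_cover n W cl \<and>
           (\<forall>V. arithmetic_rep_cover n W V \<longrightarrow> cl \<subseteq> V) \<and>
           (\<exists>r h. is_lub (L_lat n) (Some (r, h)) ((\<lambda>w. Some (r_w n w, h_w n w)) ` W) \<and>
                  cl = W_rh n r h)"
proof -
  note n = assms(1)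
  define P where "P = (\<lambda>w. (r_w n w, h_w n w)) ` W"
  have "\<bar>n - 1\<bar> > 0" using n by auto
  then have PC: "P \<subseteq> {0..<\<bar>n - 1\<bar>} \<times> {h. h > 0 \<and> coprime h n}"
    using h_w_pos_coprime[OF n] assms(2) by (auto simp: P_def r_w_def)
  have P: "finite P" "P \<noteq> {}"
    using assms by (auto simp: P_def)
  obtain r h where rh: "0 \<le> r" "r < \<bar>n - 1\<bar>" "h > 0" "coprime h n"
    and ub: "\<And>p. p \<in> P \<Longrightarrow> L_le n (Some p) (Some (r, h))"
    and least: "\<And>r' h'. (\<And>p. p \<in> P \<Longrightarrow> L_le n (Some p) (Some (r', h'))) \<Longrightarrow>
       L_le n (Some (r, h)) (Some (r', h'))"
    using L_lat_finite_lub[OF n P PC] by metis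
  have lub: "is_lub (L_lat n) (Some (r, h)) ((\<lambda>w. Some (r_w n w, h_w n w)) ` W)"
    using is_lub_L_lat[OF rh P(2) PC ub least] by (simp add: P_def image_image)
  have covers: "W \<subseteq> W_rh n r' h' \<longleftrightarrow> (\<forall>p\<in>P. L_le n (Some p) (Some (r', h')))"
    if "h' > 0" for r' h'
    using mem_W_rh_iff_L_le[OF n that] assms(2) unfolding P_def by blast
  \<comment> \<open>The progression starts at \<open>- r\<close> because
    \<open>rep_words_arithmetic\<close> takes the residue to be the negative of the first
    term.\<close>
  obtain D where D: "complete_residue_system n D"
    and e: "\<forall>i\<in>alphabet n. res_elem D i = - r + int i * h"
    using arithmetic_residue_system_exists[OF n rh(3,4), of "- r"] by blast
  have "0 \<in> alphabet n" using n by (simp add: alphabet_def)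
  then have "arithmetic_sequence n D"
    unfolding arithmetic_sequence_def using e rh(3) by (intro exI[of _ h]) auto
  moreover have "rep_words n D = W_rh n r h"
    by (rule rep_words_arithmetic[OF n D rh(3) e]) simp
  ultimately have cover: "arithmetic_rep_cover n W (W_rh n r h)"
    unfolding arithmetic_rep_cover_def using covers[OF rh(3)] ub D by (auto simp: W_rh_def)
  have "W_rh n r h \<subseteq> V" if V: "arithmetic_rep_cover n W V" for V
  proof -
    obtain D' h' where D': "complete_residue_system n D'" and h': "h' > 0"
      and e': "\<forall>i\<in>alphabet n. res_elem D' i = res_elem D' 0 + int i * h'"
      and WV: "W \<subseteq> V" "V = rep_words n D'"
      using V unfolding arithmetic_rep_cover_def arithmetic_sequence_def by blast
    let ?r' = "- res_elem D' 0"
    have V': "V = W_rh n ?r' h'"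
      unfolding WV(2) by (rule rep_words_arithmetic[OF n D' h' e']) simp
    \<comment> \<open>Since \<open>V\<close> contains \<open>W\<close>, the pair of
      \<open>D'\<close> is an upper bound of \<open>P\<close>, hence lies above the join;
      transitivity then carries every word of \<open>W_rh n r h\<close> into
      \<open>V\<close>.\<close>
    then have le: "L_le n (Some (r, h)) (Some (?r', h'))"
      using covers[OF h'] WV(1) by (intro least) blast
    show ?thesis
    proof
      fix w assume w: "w \<in> W_rh n r h"
      then have wp: "w \<in> prim_words n" by (simp add: W_rh_def)
      show "w \<in> V"
        using w L_le_trans[OF _ le h_w_pos_coprime(1)[OF n wp] rh(3)]
        unfolding V' mem_W_rh_iff_L_le[OF n h' wp] mem_W_rh_iff_L_le[OF n rh(3) wp] by blast
    qed
  qed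
  with cover lub show ?thesis by blast
qed

end
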